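(* Let $X:[0,\infty)\to\mathbb{R}^n$ be a càdlàg function and let $i\in\{1,\ldots,n\}$. If for every $a\in[0,\infty)^n$ $$\lim_{t\to\infty}\bigl(W_i(a+X)(t)-W_i(X)(t)\bigr)=0,$$ then $(R^{-1}M(X))_i$ is unbounded on $[0,\infty)$ and, thus, $M_j(X)$ is unbounded (that is, $\liminf_{t\to\infty}X_j(t)=-\infty$) for at least one $j\in\{1,\ldots,n\}$.
   Context: Fix $n\ge 1$ and an $n\times n$ matrix $P=(p_{ij})$ with nonnegative entries and spectral radius strictly less than one. Put $R=I-P^t$, where $^t$ denotes transposition (so $R$ is invertible with $R^{-1}$ entrywise nonnegative). For a càdlàg (right continuous with left limits) function $X:[0,\infty)\to\mathbb{R}^n$, the reflection map (Skorohod problem in $[0,\infty)^n$) gives the unique pair $(W(X),L(X))$ of $\mathbb{R}^n$-valued functions on $[0,\infty)$ with $W(X)(t)=X(t)+R\,L(X)(t)$ for all $t\ge 0$ and, for each $i=1,\ldots,n$: (S1) $L_i(X)$ is nondecreasing, nonnegative and right continuous; (S2) $W_i(X)$ is nonnegative; (S3) $\int_{[0,\infty)}1_{\{W_i(X)(t)>0\}}\,dL_i(X)(t)=0$, where the measure $dL_i(X)$ has an atom of mass $L_i(X)(0)$ at $0$. (It is known that this pair exists and is unique.) A subscript $i$ denotes the $i$th coordinate, and for a constant vector $a$, $a+X$ denotes the function $t\mapsto a+X(t)$. With the convention $x^-=\min(x,0)$ for $x\in\mathbb{R}$, define $M(X)=(M_1(X),\ldots,M_n(X))^t$ by $M_j(X)(t)=-\inf_{0\le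 s\le t}X_j(s)^-$ for $t\ge 0$. *)

theory Defs
  imports "HOL-Analysis.Analysis"
begin

definition eigenvalue_of :: "complex^'n^'n \<Rightarrow> complex \<Rightarrow> bool" where
  "eigenvalue_of A z \<longleftrightarrow> (\<exists>v. v \<noteq> 0 \<and> A *v v = z *s v)"

text \<open>The eigenvalues of a real matrix are taken over the complex numbers; the set of them is
  finite and nonempty.\<close>

definition spectral_radius :: "real^'n^'n \<Rightarrow> real" where
  "spectral_radius A = Max (cmod ` {z. eigenvalue_of (map_matrix complex_of_real A) z})"

text \<open>Paths on the half line \<open>[0,\<infinity>)\<close> are functions on \<^typ>\<open>real\<close>; values of the driving path at
  negative times are irrelevant in all definitions below.\<close>

definition cadlag :: "(real \<Rightarrow> 'a::topological_space) \<Rightarrow> bool" where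
  "cadlag X \<longleftrightarrow> (\<forall>t\<ge>0. (X \<longlongrightarrow> X t) (at_right t)) \<and> (\<forall>t>0. \<exists>l. (X \<longlongrightarrow> l) (at_left t))"

definition reflection_matrix :: "real^'n^'n \<Rightarrow> real^'n^'n" where
  "reflection_matrix P = mat 1 - transpose P"

text \<open>The solutions \<open>W\<close>, \<open>L\<close> are extended by \<open>0\<close> to negative times. This makes the pair unique as
  a pair of total functions, and it gives the Lebesgue-Stieltjes measure of \<open>L\<^sub>i\<close> an atom of mass
  \<open>L\<^sub>i(0)\<close> at \<open>0\<close>.\<close>

definition skorohod_solution ::
  "real^'n^'n \<Rightarrow> (real \<Rightarrow> real^'n) \<Rightarrow> (real \<Rightarrow> real^'n) \<Rightarrow> (real \<Rightarrow> real^'n) \<Rightarrow> bool" where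
  "skorohod_solution R X W L \<longleftrightarrow>
     (\<forall>t<0. W t = 0 \<and> L t = 0) \<and>
     (\<forall>t\<ge>0. W t = X t + R *v L t) \<and>
     (\<forall>i. mono_on {0..} (\<lambda>t. L t $ i) \<and>
          (\<forall>t\<ge>0. 0 \<le> L t $ i) \<and>
          (\<forall>t\<ge>0. continuous (at_right t) (\<lambda>t. L t $ i)) \<and>
          (\<forall>t\<ge>0. 0 \<le> W t $ i) \<and>
          (\<integral>\<^sup>+t\<in>{0..}. indicator {t. W t $ i > 0} t \<partial>interval_measure (\<lambda>t. L t $ i)) = 0)"

definition reflection_map ::
  "real^'n^'n \<Rightarrow> (real \<Rightarrow> real^'n) \<Rightarrow> (real \<Rightarrow> real^'n) \<times> (real \<Rightarrow> real^'n)" where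
  "reflection_map R X = (THE (W, L). skorohod_solution R X W L)"

definition reflected_path :: "real^'n^'n \<Rightarrow> (real \<Rightarrow> real^'n) \<Rightarrow> real \<Rightarrow> real^'n" where
  "reflected_path R X = fst (reflection_map R X)"

text \<open>The convention is that the negative part is nonpositive.\<close>

definition neg_part :: "real \<Rightarrow> real" where
  "neg_part x = min x 0"

definition running_deficit :: "(real \<Rightarrow> real^'n) \<Rightarrow> real \<Rightarrow> real^'n" where
  "running_deficit X t = (\<chi> j. - (INF s\<in>{0..t}. neg_part (X s $ j)))"

end

theory Submission
  imports Defs "HOL-Computational_Algebra.Polynomial"
begin

text \<open>
  Two facts about the reflection map carry the proof. The regulator \<open>L\<close> of \<open>X\<close> is the least
  among all paths \<open>Y\<close> that are nondecreasing, nonnegative and satisfy \<open>X + R Y \<ge> 0\<close>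
  (\<open>feasible\<close> below). Since \<open>X + M(X) \<ge> 0\<close> and \<open>R\<inverse>\<close> is nonnegative, \<open>R\<inverse> M(X)\<close> is
  such a path, and so \<open>L(X) \<le> R\<inverse> M(X)\<close>. For \<open>a \<ge> 0\<close> the regulator of \<open>X\<close> is feasible for \<open>a + X\<close>,
  and so \<open>L(a + X) \<le> L(X)\<close>. Subtracting the equations \<open>W = X + (I - P\<^sup>t) L\<close> gives

  \<open>W\<^sub>i(a+X) - W\<^sub>i(X) = a\<^sub>i + L\<^sub>i(a+X) - L\<^sub>i(X) + (P\<^sup>t (L(X) - L(a+X)))\<^sub>i \<ge> a\<^sub>i - L\<^sub>i(X) \<ge> a\<^sub>i - (R\<inverse> M(X))\<^sub>i\<close>,

  which is \<open>reflected_path_shift_ge\<close>. If \<open>(R\<inverse> M(X))\<^sub>i\<close> were bounded by \<open>b\<close>, then for \<open>a\<^sub>i = b + 1\<close>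
  the difference could not tend to \<open>0\<close>. Some \<open>M\<^sub>j(X)\<close> is then unbounded, because
  \<open>(R\<inverse> M(X))\<^sub>i\<close> is a fixed linear combination of them; and as a cadlag path is bounded on compact
  intervals, the infimum \<open>-\<infinity>\<close> of \<open>X\<^sub>j\<close> is approached only as \<open>t \<rightarrow> \<infinity>\<close>.

  The reflected path is defined by a description operator, so existence and uniqueness of the
  Skorohod solution are proved as well. Both go through the property \<open>tight\<close>: \<open>L\<^sub>i(t)\<close> does not
  exceed a level \<open>m \<ge> 0\<close> unless \<open>(P\<^sup>t L)\<^sub>i - X\<^sub>i\<close> exceeds it somewhere on \<open>[0,t]\<close>. The
  complementarity condition (\<open>L\<^sub>i\<close> grows only where \<open>W\<^sub>i = 0\<close>) implies tightness,
  and a tight feasible path lies below every feasible one (\<open>tight_le_feasible\<close>), which gives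
  uniqueness and minimality at once. Conversely, the pointwise infimum of all feasible paths is
  tight, and tightness forces right continuity and complementarity.

  The spectral radius enters only through a vector \<open>w \<ge> 0\<close> with \<open>P w = w - 1\<close>
  (\<open>exists_weight_vector\<close>). Pairing with \<open>w\<close> shows that \<open>v \<le> P\<^sup>t v + e\<close> implies
  \<open>\<Sum>\<^sub>k v\<^sub>k \<le> e \<Sum>\<^sub>k w\<^sub>k\<close>; this one inequality yields that \<open>R\<inverse>\<close> exists and is nonnegative, the
  comparison of tight and feasible paths, and right continuity.
\<close>

section \<open>A weight vector for a nonnegative matrix of spectral radius below one\<close>

lemma finite_type_maximum:
  fixes f :: "'n::finite \<Rightarrow> 'a::linorder"
  shows "\<exists>k. \<forall>l. f l \<le> f k"
proof -
  have "Max (range f) \<in> range f" by (intro Max_in) auto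
  then obtain k where "Max (range f) = f k" by (rule rangeE)
  moreover have "f l \<le> Max (range f)" for l by simp
  ultimately show ?thesis by auto
qed

text \<open>Without finiteness the maximum in the definition of the spectral radius would be an unspecified
  value. The eigenvalues are the roots of a polynomial, the determinant of a matrix of linear
  polynomials; it is not zero because no number above the sum of all \<open>\<bar>A\<^sub>k\<^sub>l\<bar>\<close> is an eigenvalue.\<close>

lemma finite_eigenvalues:
  fixes A :: "complex^'n^'n"
  shows "finite {z. eigenvalue_of A z}"
proof -
  define p :: "complex poly"
    where "p = det (\<chi> k l. [:A $ k $ l, if k = l then - 1 else 0:])"
  have poly_p: "poly p z = det (A - mat z)" for z
    by (simp add: p_def det_def poly_sum poly_prod mat_def if_distrib cong: if_cong)
      (intro sum.cong prod.cong refl arg_cong2[where f = "(*)"], auto simp: of_int_poly[symmetric])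
  have root: "poly p z = 0 \<longleftrightarrow> eigenvalue_of A z" for z
  proof -
    have "(A - mat z) *v v = A *v v - z *s v" for v
      by (simp add: vec_eq_iff matrix_vector_mult_def mat_def sum_subtractf left_diff_distrib
          if_distrib[where f = "\<lambda>x. x * _"] cong: if_cong)
    then have "(\<exists>v. v \<noteq> 0 \<and> (A - mat z) *v v = 0) \<longleftrightarrow> eigenvalue_of A z"
      by (simp add: eigenvalue_of_def)
    moreover have "(\<exists>v. v \<noteq> 0 \<and> (A - mat z) *v v = 0) \<longleftrightarrow> \<not> invertible (A - mat z)"
      by (metis invertible_left_inverse matrix_left_invertible_ker)
    ultimately show ?thesis
      by (simp add: poly_p invertible_det_nz)
  qed
  define c where "c = (\<Sum>k\<in>UNIV. \<Sum>l\<in>UNIV. cmod (A $ k $ l))"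
  have "c \<ge> 0" by (simp add: c_def sum_nonneg)
  have "\<not> eigenvalue_of A (of_real (c + 1))"
  proof
    assume "eigenvalue_of A (of_real (c + 1))"
    then obtain v where v: "v \<noteq> 0" "A *v v = of_real (c + 1) *s v"
      by (auto simp: eigenvalue_of_def)
    obtain k where k: "\<And>l. cmod (v $ l) \<le> cmod (v $ k)"
      using finite_type_maximum[of "\<lambda>l. cmod (v $ l)"] by blast
    have "cmod (v $ k) > 0"
    proof (rule ccontr)
      assume "\<not> cmod (v $ k) > 0"
      with k have "v $ l = 0" for l
        by (metis norm_le_zero_iff order.trans not_le)
      with v show False by (simp add: vec_eq_iff)
    qed
    have "(c + 1) * cmod (v $ k) = cmod ((A *v v) $ k)"
      using \<open>c \<ge> 0\<close> by (simp add: v norm_mult del: of_real_add)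
    also have "\<dots> \<le> (\<Sum>l\<in>UNIV. cmod (A $ k $ l) * cmod (v $ l))"
      unfolding matrix_vector_mult_def by (simp add: sum_norm_le norm_mult)
    also have "\<dots> \<le> (\<Sum>l\<in>UNIV. cmod (A $ k $ l)) * cmod (v $ k)"
      unfolding sum_distrib_right by (intro sum_mono mult_left_mono k) simp
    also have "\<dots> \<le> c * cmod (v $ k)"
      unfolding c_def
      by (intro mult_right_mono member_le_sum) (auto simp: sum_nonneg)
    finally show False
      using \<open>cmod (v $ k) > 0\<close> by (simp add: algebra_simps)
  qed
  then have "p \<noteq> 0"
    using root by fastforce
  then show ?thesis
    using poly_roots_finite[of p] by (simp add: root)
qed

lemma real_eigenvector_bound:
  fixes A :: "real^'n^'n"
  assumes "A *v v = t *s v" "v \<noteq> 0"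
  shows "t \<le> spectral_radius A"
proof -
  let ?c = "\<lambda>v. (\<chi> k. complex_of_real (v $ k)) :: complex^'n"
  have "map_matrix complex_of_real A *v ?c v = ?c (A *v v)"
    by (simp add: vec_eq_iff matrix_vector_mult_def map_matrix_def)
  also have "\<dots> = complex_of_real t *s ?c v"
    by (simp add: assms vec_eq_iff)
  finally have "eigenvalue_of (map_matrix complex_of_real A) (complex_of_real t)"
    using assms(2) unfolding eigenvalue_of_def
    by (intro exI[of _ "?c v"]) (auto simp: vec_eq_iff)
  then have "cmod (complex_of_real t) \<le> spectral_radius A"
    unfolding spectral_radius_def
    by (intro Max_ge finite_imageI finite_eigenvalues imageI) simp
  then show ?thesis by simp
qed

text \<open>The vector is \<open>u(1)\<close>, where \<open>u(t) = (t I - P)\<inverse> 1\<close>. For \<open>t \<ge> 1\<close> the inverse exists because \<open>t\<close>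
  is not an eigenvalue, and \<open>u\<close> is continuous by Cramer's rule. Since \<open>t u = 1 + P u\<close>, the conditions
  \<open>u(t) \<ge> 0\<close> and \<open>u(t) > 0\<close> are equivalent; the set of \<open>t \<ge> 1\<close> satisfying them is therefore open
  and closed in \<open>[1,\<infinity>)\<close>. It contains a number \<open>T\<close> exceeding all row sums of \<open>P\<close>, hence
  also \<open>1\<close>.\<close>

lemma exists_weight_vector:
  fixes P :: "real^'n^'n"
  assumes nonneg: "\<And>k l. 0 \<le> P $ k $ l"
    and radius: "spectral_radius P < 1"
  shows "\<exists>w. \<forall>k. 0 \<le> w $ k \<and> (P *v w) $ k = w $ k - 1"
proof -
  define Q :: "real \<Rightarrow> real^'n^'n" where "Q t = mat t - P" for t
  have Q_apply: "Q t *v v = t *s v - P *v v" for t v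
    by (simp add: Q_def vec_eq_iff matrix_vector_mult_def mat_def sum_subtractf left_diff_distrib
        if_distrib[where f = "\<lambda>x. x * _"] cong: if_cong)
  have det: "det (Q t) \<noteq> 0" if "t \<ge> 1" for t
  proof -
    have "v = 0" if "Q t *v v = 0" for v
      using real_eigenvector_bound[of P v t] that radius \<open>t \<ge> 1\<close> by (auto simp: Q_apply)
    then show ?thesis
      by (metis invertible_left_inverse matrix_left_invertible_ker invertible_det_nz)
  qed
  define u where "u t = (\<chi> k. det (\<chi> i j. if j = k then 1 else Q t $ i $ j) / det (Q t))" for t
  have "Q t *v u t = (\<chi> k. 1)" if "t \<ge> 1" for t
    using cramer[OF det[OF that], of "u t" "\<chi> k. 1"] by (simp add: u_def cong: if_cong)
  then have u: "t * u t $ k = 1 + (P *v u t) $ k" if "t \<ge> 1" for t k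
    using that by (simp add: Q_apply vec_eq_iff algebra_simps)
  have entry: "continuous_on {1..} (\<lambda>t. Q t $ k $ l)" for k l
    by (cases "k = l") (auto simp: Q_def mat_def intro!: continuous_intros)
  have det_cont: "continuous_on {1..} (\<lambda>t. det (F t))"
    if "\<And>k l. continuous_on {1..} (\<lambda>t. F t $ k $ l)" for F :: "real \<Rightarrow> real^'n^'n"
    unfolding det_def by (intro continuous_intros that)
  have replaced: "continuous_on {1..} (\<lambda>t. (\<chi> i j. if j = k then 1 else Q t $ i $ j) $ a $ b)"
    for k a b
    by (cases "b = k") (simp_all add: entry)
  have cont: "continuous_on {1..} (\<lambda>t. u t $ k)" for k
    unfolding u_def vec_lambda_beta
    by (intro continuous_on_divide det_cont entry replaced) (use det in simp)
  have pos: "u t $ k > 0" if "t \<ge> 1" "\<And>k. u t $ k \<ge> 0" for t k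
  proof -
    have "(P *v u t) $ k \<ge> 0"
      by (auto simp: matrix_vector_mult_def intro!: sum_nonneg mult_nonneg_nonneg nonneg that)
    with u[OF that(1), of k] have "t * u t $ k > 0" by simp
    with that(1) show ?thesis by (simp add: zero_less_mult_iff)
  qed
  define c where "c = (\<Sum>k\<in>UNIV. \<Sum>l\<in>UNIV. P $ k $ l)"
  have "c \<ge> 0" by (simp add: c_def sum_nonneg nonneg)
  \<comment> \<open>As \<open>T\<close> is larger than every row sum of \<open>P\<close>, a negative smallest coordinate of \<open>u(T)\<close>
    would contradict the equation for that coordinate.\<close>
  define T where "T = c + 1"
  have T: "u T $ k \<ge> 0" for k
  proof -
    have "T \<ge> 1" using \<open>c \<ge> 0\<close> by (simp add: T_def)
    obtain m where m: "\<And>l. u T $ m \<le> u T $ l"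
      using finite_type_maximum[of "\<lambda>l. - u T $ l"] by auto
    have "u T $ m \<ge> 0"
    proof (rule ccontr)
      assume neg: "\<not> u T $ m \<ge> 0"
      have "c * u T $ m \<le> (\<Sum>l\<in>UNIV. P $ m $ l) * u T $ m"
        unfolding c_def using neg
        by (intro mult_right_mono_neg member_le_sum) (auto simp: sum_nonneg nonneg)
      also have "\<dots> \<le> (P *v u T) $ m"
        unfolding matrix_vector_mult_def vec_lambda_beta sum_distrib_right
        by (intro sum_mono mult_left_mono m nonneg)
      finally have "T * u T $ m \<ge> 1 + c * u T $ m"
        using u[OF \<open>T \<ge> 1\<close>, of m] by simp
      with neg show False by (simp add: T_def algebra_simps)
    qed
    with m[of k] show ?thesis by simp
  qed
  define S where "S = {t\<in>{1..}. \<forall>k. u t $ k \<in> {0..}}"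
  have S_eq: "S = {t\<in>{1..}. \<forall>k. u t $ k \<in> {0<..}}"
    using pos by (force simp: S_def intro: less_imp_le)
  have "S = (\<Inter>k. {1..} \<inter> (\<lambda>t. u t $ k) -` {0..})"
    by (auto simp: S_def)
  also have "closedin (top_of_set {1..}) \<dots>"
    by (intro closedin_INT continuous_closedin_preimage cont closed_atLeast) auto
  finally have closed: "closedin (top_of_set {1..}) S" .
  have "S = (\<Inter>k. {1..} \<inter> (\<lambda>t. u t $ k) -` {0<..})"
    by (auto simp: S_eq)
  also have "openin (top_of_set {1..}) \<dots>"
    by (intro openin_INT2 continuous_openin_preimage_gen cont open_greaterThan) auto
  finally have opn: "openin (top_of_set {1..}) S" .
  have "T \<in> S" using T \<open>c \<ge> 0\<close> by (auto simp: S_def T_def)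
  then have "S = {1..}"
    using closed opn connected_clopen[of "{1::real..}"] by auto
  then have "1 \<in> S" by simp
  then show ?thesis
    using u[of 1] by (intro exI[of _ "u 1"]) (auto simp: S_def)
qed

section \<open>Null sets of Lebesgue-Stieltjes measures\<close>

lemma atom_null:
  fixes F :: "real \<Rightarrow> real"
  assumes mono: "\<And>x y. x \<le> y \<Longrightarrow> F x \<le> F y"
    and rc: "\<And>a. continuous (at_right a) F"
    and small: "\<And>e. e > 0 \<Longrightarrow> \<exists>s<t. F t - F s < e"
  shows "{t} \<in> null_sets (interval_measure F)"
proof -
  have "emeasure (interval_measure F) {t} \<le> 0"
  proof (rule ennreal_le_epsilon)
    fix e :: real
    assume "e > 0"
    then obtain s where s: "s < t" "F t - F s < e" using small by blast
    have "emeasure (interval_measure F) {t} \<le> emeasure (interval_measure F) {s<..t}"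
      using s by (intro emeasure_mono) auto
    also have "\<dots> = F t - F s"
      using s by (intro emeasure_interval_measure_Ioc mono rc) auto
    also have "\<dots> \<le> ennreal e" using s by (intro ennreal_leI) simp
    finally show "emeasure (interval_measure F) {t} \<le> 0 + ennreal e" by simp
  qed
  then show ?thesis by (auto intro: null_setsI)
qed

text \<open>A point to the right of which \<open>F\<close> is flat for a while can still be the right end of an interval of
  increase, or carry an atom; the last hypothesis excludes an atom. The points of \<open>G\<close> that lie on
  the flat stretch ending at a rational \<open>q\<close> form a null set: its leftmost point \<open>\<tau>\<close>, if it is in \<open>G\<close>,
  is no atom, and \<open>F(\<tau>) = F(q)\<close> by right continuity, so that the rest \<open>(\<tau>,q]\<close> has measure zero.\<close>

lemma AE_notin_flat_set:
  fixes F :: "real \<Rightarrow> real"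
  assumes mono: "\<And>x y. x \<le> y \<Longrightarrow> F x \<le> F y"
    and rc: "\<And>a. continuous (at_right a) F"
    and bdd: "bdd_below G"
    and flat: "\<And>t. t \<in> G \<Longrightarrow> \<exists>q>t. F q = F t"
    and small: "\<And>t e. t \<in> G \<Longrightarrow> e > 0 \<Longrightarrow> \<exists>s<t. F t - F s < e"
  shows "AE t in interval_measure F. t \<notin> G"
proof -
  have "\<exists>M \<in> null_sets (interval_measure F). {t\<in>G. t \<le> q \<and> F t = F q} \<subseteq> M" for q
  proof (cases "{t\<in>G. t \<le> q \<and> F t = F q} = {}")
    case False
    define N where "N = {t\<in>G. t \<le> q \<and> F t = F q}"
    define \<tau> where "\<tau> = Inf N"
    have N: "N \<noteq> {}" "bdd_below N"
      using False bdd by (auto simp: N_def intro: bdd_below_mono)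
    have le: "\<tau> \<le> t" if "t \<in> N" for t
      unfolding \<tau>_def using that N by (intro cInf_lower) auto
    have "\<tau> \<le> q" using N le by (force simp: N_def)
    have "F q \<le> F \<tau>"
    proof -
      have "(F \<longlongrightarrow> F \<tau>) (at_right \<tau>)"
        using rc[of \<tau>] by (simp add: continuous_within)
      moreover have "eventually (\<lambda>s. F q \<le> F s) (at_right \<tau>)"
      proof (rule eventually_at_rightI[of _ "\<tau> + 1"])
        fix s assume "s \<in> {\<tau><..<\<tau> + 1}"
        then obtain t where "t \<in> N" "t < s"
          using cInf_lessD[OF N(1), of s] by (auto simp: \<tau>_def)
        then show "F q \<le> F s" using mono[of t s] by (auto simp: N_def)
      qed simp
      ultimately show ?thesis
        by (intro tendsto_lowerbound[of F "F \<tau>" "at_right \<tau>"]) auto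
    qed
    then have "emeasure (interval_measure F) {\<tau><..q} = 0"
      using mono[OF \<open>\<tau> \<le> q\<close>] \<open>\<tau> \<le> q\<close>
      by (subst emeasure_interval_measure_Ioc) (auto intro: mono rc)
    then have Ioc: "{\<tau><..q} \<in> null_sets (interval_measure F)"
      by (auto intro: null_setsI)
    have atom: "{\<tau>} \<in> null_sets (interval_measure F)" if "\<tau> \<in> N"
      using that by (intro atom_null mono rc small) (auto simp: N_def)
    have "N \<subseteq> {\<tau><..q} \<union> (if \<tau> \<in> N then {\<tau>} else {})"
    proof
      fix t assume "t \<in> N"
      then have "\<tau> \<le> t" "t \<le> q" using le by (auto simp: N_def)
      with \<open>t \<in> N\<close> show "t \<in> {\<tau><..q} \<union> (if \<tau> \<in> N then {\<tau>} else {})"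
        by (cases "t = \<tau>") auto
    qed
    moreover have "{\<tau><..q} \<union> (if \<tau> \<in> N then {\<tau>} else {}) \<in> null_sets (interval_measure F)"
      using Ioc atom by (auto simp del: Un_insert_right)
    ultimately show ?thesis unfolding N_def by blast
  qed (auto intro: bexI[of _ "{}"])
  then obtain M where M: "\<And>q. M q \<in> null_sets (interval_measure F)"
    "\<And>q. {t\<in>G. t \<le> q \<and> F t = F q} \<subseteq> M q"
    by metis
  have "G \<subseteq> (\<Union>q\<in>\<rat>. M q)"
  proof
    fix t assume "t \<in> G"
    then obtain q where q: "q > t" "F q = F t" using flat by blast
    then obtain r where r: "r \<in> \<rat>" "t < r" "r < q" using Rats_dense_in_real by blast
    then have "F r = F t" using mono[of t r] mono[of r q] q by simp
    with M(2)[of r] r \<open>t \<in> G\<close> show "t \<in> (\<Union>q\<in>\<rat>. M q)" by auto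
  qed
  moreover have "(\<Union>q\<in>\<rat>. M q) \<in> null_sets (interval_measure F)"
    by (intro null_sets_UN' countable_rat M)
  ultimately show ?thesis by (intro AE_I') auto
qed

section \<open>The inverse of the reflection matrix\<close>

text \<open>The matrix \<open>P\<close> is read as the routing matrix of an open network, so that \<open>P\<^sup>t v\<close> is the flow into
  the stations; \<open>w = (I - P)\<inverse> 1\<close> counts the expected visits of a customer before leaving. All the
  linear algebra below uses \<open>w\<close> in place of the spectral radius.\<close>

locale subcritical_routing =
  fixes P :: "real^'n^'n" and w :: "real^'n"
  assumes nonneg: "0 \<le> P $ k $ l"
    and weight_nonneg: "0 \<le> w $ k"
    and weight: "(P *v w) $ k = w $ k - 1"
begin

abbreviation R :: "real^'n^'n" where
  "R \<equiv> reflection_matrix P"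

abbreviation inflow :: "real^'n \<Rightarrow> 'n \<Rightarrow> real" where
  "inflow v k \<equiv> \<Sum>l\<in>UNIV. P $ l $ k * v $ l"

lemma R_apply: "(R *v v) $ k = v $ k - inflow v k"
  by (simp add: reflection_matrix_def matrix_vector_mult_def mat_def transpose_def
      sum_subtractf left_diff_distrib if_distrib[where f = "\<lambda>x. x * _"] cong: if_cong)

lemma inflow_mono: "(\<And>l. u $ l \<le> v $ l) \<Longrightarrow> inflow u k \<le> inflow v k"
  by (intro sum_mono mult_left_mono nonneg)

lemma inflow_nonneg: "(\<And>l. 0 \<le> v $ l) \<Longrightarrow> 0 \<le> inflow v k"
  by (intro sum_nonneg mult_nonneg_nonneg nonneg)

lemma inflow_add: "inflow (u + v) k = inflow u k + inflow v k"
  by (simp add: algebra_simps sum.distrib)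

lemma inflow_diff: "inflow (u - v) k = inflow u k - inflow v k"
  by (simp add: algebra_simps sum_subtractf)

text \<open>Multiply by \<open>w\<^sub>k\<close>, sum over \<open>k\<close> and use \<open>\<langle>w, P\<^sup>t v\<rangle> = \<langle>P w, v\<rangle> = \<langle>w, v\<rangle> - \<Sum>\<^sub>k v\<^sub>k\<close>.\<close>

lemma sum_le_of_le_inflow:
  assumes "\<And>k. v $ k \<le> inflow v k + e"
  shows "(\<Sum>k\<in>UNIV. v $ k) \<le> e * (\<Sum>k\<in>UNIV. w $ k)"
proof -
  have "(\<Sum>k\<in>UNIV. w $ k * v $ k) \<le> (\<Sum>k\<in>UNIV. w $ k * (inflow v k + e))"
    by (intro sum_mono mult_left_mono assms weight_nonneg)
  also have "\<dots> = (\<Sum>k\<in>UNIV. \<Sum>l\<in>UNIV. w $ k * (P $ l $ k * v $ l)) + e * (\<Sum>k\<in>UNIV. w $ k)"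
    by (simp add: ring_distribs sum.distrib sum_distrib_left mult.commute)
  also have "(\<Sum>k\<in>UNIV. \<Sum>l\<in>UNIV. w $ k * (P $ l $ k * v $ l)) = (\<Sum>l\<in>UNIV. (P *v w) $ l * v $ l)"
    by (subst sum.swap) (simp add: matrix_vector_mult_def sum_distrib_left sum_distrib_right mult_ac)
  also have "\<dots> = (\<Sum>l\<in>UNIV. w $ l * v $ l) - (\<Sum>l\<in>UNIV. v $ l)"
    by (simp add: weight left_diff_distrib sum_subtractf)
  finally show ?thesis by simp
qed

lemma eq_0_of_le_inflow:
  assumes "\<And>k. 0 \<le> v $ k" "\<And>k. v $ k \<le> inflow v k"
  shows "v $ k = 0"
proof -
  have "(\<Sum>k\<in>UNIV. v $ k) \<le> 0"
    using sum_le_of_le_inflow[of v 0] assms(2) by simp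
  then have "(\<Sum>k\<in>UNIV. v $ k) = 0"
    using assms(1) by (intro antisym sum_nonneg) auto
  then show ?thesis
    using assms(1) by (simp add: sum_nonneg_eq_0_iff)
qed

text \<open>If \<open>v - P\<^sup>t v \<ge> 0\<close>, then the vector \<open>n\<close> of the numbers \<open>max 0 (- v\<^sub>k)\<close> satisfies \<open>n \<le> P\<^sup>t n\<close> and vanishes.\<close>

lemma nonneg_of_R_nonneg:
  assumes "\<And>k. 0 \<le> (R *v v) $ k"
  shows "0 \<le> v $ k"
proof -
  define n where "n = (\<chi> k. max 0 (- v $ k))"
  have "n $ k \<le> inflow n k" for k
  proof -
    have "- v $ k \<le> inflow (- v) k"
      using assms[of k] by (simp add: R_apply sum_negf)
    also have "\<dots> \<le> inflow n k" by (intro inflow_mono) (simp add: n_def)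
    finally have "- v $ k \<le> inflow n k" .
    moreover have "0 \<le> inflow n k" by (intro inflow_nonneg) (simp add: n_def)
    ultimately show ?thesis by (simp add: n_def)
  qed
  then have "n $ k = 0" by (intro eq_0_of_le_inflow) (auto simp: n_def)
  then show ?thesis by (simp add: n_def)
qed

lemma R_mult_inverse: "R *v (matrix_inv R *v v) = v"
proof -
  have "v = 0" if "R *v v = 0" for v
  proof -
    have "0 \<le> v $ k" for k
      by (rule nonneg_of_R_nonneg) (simp add: that)
    moreover have "0 \<le> (- v) $ k" for k
    proof (rule nonneg_of_R_nonneg)
      have "(R *v (- v)) $ l = - (R *v v) $ l" for l
        by (simp only: R_apply) (simp add: sum_negf)
      then show "0 \<le> (R *v (- v)) $ l" for l by (simp add: that)
    qed
    ultimately show ?thesis by (auto simp: vec_eq_iff intro: antisym)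
  qed
  then have "invertible R"
    by (metis invertible_left_inverse matrix_left_invertible_ker)
  then have "R ** matrix_inv R = mat 1"
    unfolding matrix_inv_def invertible_def by (rule someI2_ex) simp
  then show ?thesis
    by (simp add: matrix_vector_mul_assoc)
qed

lemma inverse_nonneg: "(\<And>k. 0 \<le> v $ k) \<Longrightarrow> 0 \<le> (matrix_inv R *v v) $ k"
  by (rule nonneg_of_R_nonneg) (simp add: R_mult_inverse)

section \<open>Feasible and tight regulators\<close>

definition feasible :: "(real \<Rightarrow> real^'n) \<Rightarrow> (real \<Rightarrow> real^'n) \<Rightarrow> bool" where
  "feasible X Y \<longleftrightarrow>
     (\<forall>i. mono_on {0..} (\<lambda>t. Y t $ i)) \<and> (\<forall>t\<ge>0. \<forall>i. 0 \<le> Y t $ i \<and> 0 \<le> (X t + R *v Y t) $ i)"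

text \<open>This says \<open>L\<^sub>i(t) \<le> sup {max 0 ((P\<^sup>t L)\<^sub>i(s) - X\<^sub>i(s)) | 0 \<le> s \<le> t}\<close>, phrased with upper bounds \<open>m\<close>
  in place of the supremum. A feasible path satisfies the opposite inequality, and the tight
  feasible paths are the fixed points of this supremum operator.\<close>

definition tight :: "(real \<Rightarrow> real^'n) \<Rightarrow> (real \<Rightarrow> real^'n) \<Rightarrow> bool" where
  "tight X L \<longleftrightarrow>
     (\<forall>i. \<forall>t\<ge>0. \<forall>m\<ge>0. (\<forall>s\<in>{0..t}. inflow (L s) i - X s $ i \<le> m) \<longrightarrow> L t $ i \<le> m)"

lemma tightD:
  assumes "tight X L" "0 \<le> t" "0 \<le> m" "\<And>s. 0 \<le> s \<Longrightarrow> s \<le> t \<Longrightarrow> inflow (L s) i - X s $ i \<le> m"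
  shows "L t $ i \<le> m"
  using assms by (auto simp: tight_def)

lemma feasibleD:
  assumes "feasible X Y"
  shows "\<And>s t i. 0 \<le> s \<Longrightarrow> s \<le> t \<Longrightarrow> Y s $ i \<le> Y t $ i"
    and "\<And>t i. 0 \<le> t \<Longrightarrow> 0 \<le> Y t $ i"
    and "\<And>t i. 0 \<le> t \<Longrightarrow> inflow (Y t) i - X t $ i \<le> Y t $ i"
proof -
  show "Y s $ i \<le> Y t $ i" if "0 \<le> s" "s \<le> t" for s t i
    using assms that by (auto simp: feasible_def mono_on_def)
  show "0 \<le> Y t $ i" if "0 \<le> t" for t i
    using assms that by (auto simp: feasible_def)
  show "inflow (Y t) i - X t $ i \<le> Y t $ i" if "0 \<le> t" for t i
  proof -
    have "0 \<le> (X t + R *v Y t) $ i" using assms that by (simp add: feasible_def)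
    then show ?thesis by (simp add: R_apply)
  qed
qed

lemma feasibleI:
  assumes "\<And>s t i. 0 \<le> s \<Longrightarrow> s \<le> t \<Longrightarrow> Y s $ i \<le> Y t $ i"
    and "\<And>t i. 0 \<le> t \<Longrightarrow> 0 \<le> Y t $ i"
    and "\<And>t i. 0 \<le> t \<Longrightarrow> inflow (Y t) i - X t $ i \<le> Y t $ i"
  shows "feasible X Y"
  using assms by (auto simp: feasible_def mono_on_def R_apply algebra_simps)

text \<open>With \<open>D\<^sub>i\<close> the supremum over \<open>[0,t]\<close> of the positive part of \<open>L\<^sub>i - Y\<^sub>i\<close>, tightness of \<open>L\<close> gives
  \<open>L\<^sub>i \<le> Y\<^sub>i + (P\<^sup>t D)\<^sub>i\<close> on \<open>[0,t]\<close>. Hence \<open>D \<le> P\<^sup>t D\<close>, which forces \<open>D = 0\<close>.\<close>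

lemma tight_le_feasible:
  assumes tight: "tight X L" and L: "feasible X L" and Y: "feasible X Y" and "0 \<le> t"
  shows "L t $ i \<le> Y t $ i"
proof -
  define D where "D = (\<chi> i. SUP s\<in>{0..t}. max 0 (L s $ i - Y s $ i))"
  have upper: "max 0 (L s $ i - Y s $ i) \<le> L t $ i" if "s \<in> {0..t}" for s i
    using feasibleD(1)[OF L, of s t i] feasibleD(2)[OF L, of t i] feasibleD(2)[OF Y, of s i] that
    by auto
  have le_D: "max 0 (L s $ i - Y s $ i) \<le> D $ i" if "s \<in> {0..t}" for s i
    unfolding D_def vec_lambda_beta using that upper
    by (intro cSUP_upper bdd_aboveI2[where M = "L t $ i"]) auto
  have D_nonneg: "0 \<le> D $ i" for i
    using le_D[of t i] \<open>0 \<le> t\<close> by simp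
  have "L s $ i - Y s $ i \<le> inflow D i" if "s \<in> {0..t}" for s i
  proof -
    have "L s $ i \<le> Y s $ i + inflow D i"
    proof (rule tightD[OF tight])
      show "0 \<le> Y s $ i + inflow D i"
        using that feasibleD(2)[OF Y, of s i] inflow_nonneg[of D i] D_nonneg by simp
      fix r assume r: "0 \<le> r" "r \<le> s"
      have "inflow (L r) i \<le> inflow (Y r + D) i"
        using le_D[of r] r that by (intro inflow_mono) (auto simp: algebra_simps)
      also have "\<dots> = inflow (Y r) i + inflow D i" by (rule inflow_add)
      finally show "inflow (L r) i - X r $ i \<le> Y s $ i + inflow D i"
        using feasibleD(3)[OF Y r(1), of i] feasibleD(1)[OF Y r, of i] by simp
    qed (use that in auto)
    then show ?thesis by simp
  qed
  then have "D $ i \<le> inflow D i" for i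
    using \<open>0 \<le> t\<close> inflow_nonneg[of D i] D_nonneg
    by (subst D_def) (auto intro!: cSUP_least)
  then have "D $ i = 0"
    by (intro eq_0_of_le_inflow D_nonneg)
  then show ?thesis
    using le_D[of t i] \<open>0 \<le> t\<close> by simp
qed

text \<open>The pointwise infimum of all feasible paths is feasible because \<open>P\<^sup>t\<close> is monotone. It is tight by
  minimality: if \<open>(P\<^sup>t L)\<^sub>i - X\<^sub>i \<le> m\<close> on \<open>[0,t]\<close>, then cutting \<open>L\<^sub>i\<close> off at the level \<open>m\<close> on \<open>[0,t]\<close> leaves
  a feasible path \<open>Z\<close>, and \<open>L \<le> Z\<close>.\<close>

lemma tight_feasible_exists:
  assumes "feasible X Y"
  obtains L where "feasible X L" "tight X L" "\<And>t. t < 0 \<Longrightarrow> L t = 0"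
proof -
  define L where "L t = (if t < 0 then 0 else (\<chi> i. INF Y\<in>Collect (feasible X). Y t $ i))" for t
  have L_le: "L t $ i \<le> Y t $ i" if "feasible X Y" "0 \<le> t" for t i Y
    using that feasibleD(2)
    by (auto simp: L_def intro!: cINF_lower bdd_belowI2[where m = 0])
  have le_L: "x \<le> L t $ i" if "0 \<le> t" "\<And>Y. feasible X Y \<Longrightarrow> x \<le> Y t $ i" for t i x
    using that assms by (auto simp: L_def intro!: cINF_greatest)
  have L: "feasible X L"
  proof (rule feasibleI)
    show "L s $ i \<le> L t $ i" if "0 \<le> s" "s \<le> t" for s t i
      using that by (intro le_L) (auto intro: order.trans[OF L_le feasibleD(1)])
    show "0 \<le> L t $ i" if "0 \<le> t" for t i
      using that by (intro le_L) (auto intro: feasibleD(2))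
    show "inflow (L t) i - X t $ i \<le> L t $ i" if "0 \<le> t" for t i
    proof (rule le_L[OF that])
      fix Y assume Y: "feasible X Y"
      have "inflow (L t) i \<le> inflow (Y t) i" by (intro inflow_mono L_le Y that)
      with feasibleD(3)[OF Y that, of i] show "inflow (L t) i - X t $ i \<le> Y t $ i" by simp
    qed
  qed
  moreover have "tight X L"
    unfolding tight_def
  proof (intro allI impI)
    fix i and t m :: real
    assume t: "0 \<le> t" and m: "0 \<le> m" and le: "\<forall>s\<in>{0..t}. inflow (L s) i - X s $ i \<le> m"
    define Z where "Z s = (\<chi> k. if k = i \<and> s \<le> t then min (L s $ k) m else L s $ k)" for s
    have Z_le: "Z s $ k \<le> L s $ k" for s k by (simp add: Z_def)
    have "feasible X Z"
    proof (rule feasibleI)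
      show "Z s $ k \<le> Z r $ k" if "0 \<le> s" "s \<le> r" for s r k
        using feasibleD(1)[OF L that, of k] that by (auto simp: Z_def)
      show "0 \<le> Z s $ k" if "0 \<le> s" for s k
        using feasibleD(2)[OF L that] m by (simp add: Z_def)
      show "inflow (Z s) k - X s $ k \<le> Z s $ k" if "0 \<le> s" for s k
      proof -
        have "inflow (Z s) k \<le> inflow (L s) k" by (intro inflow_mono Z_le)
        with feasibleD(3)[OF L that, of k] le that show ?thesis by (force simp: Z_def)
      qed
    qed
    from L_le[OF this t, of i] show "L t $ i \<le> m" by (simp add: Z_def)
  qed
  ultimately show thesis by (rule that) (simp add: L_def)
qed

section \<open>Existence and uniqueness of the Skorohod solution\<close>

text \<open>For \<open>s\<close> slightly larger than \<open>t\<close>, right continuity of \<open>X\<close> and tightness of \<open>L\<close> at \<open>s\<close> give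
  \<open>D \<le> P\<^sup>t D + h\<close> for the increment \<open>D = L(s) - L(t)\<close> and an arbitrarily small \<open>h\<close>, so \<open>D\<close> is small.\<close>

lemma tight_right_continuous:
  assumes tight: "tight X L" and L: "feasible X L"
    and X: "(X \<longlongrightarrow> X t) (at_right t)" and t: "0 \<le> t"
  shows "continuous (at_right t) (\<lambda>t. L t $ i)"
  unfolding continuous_within
proof (rule tendstoI)
  fix e :: real
  assume e: "e > 0"
  define c where "c = (\<Sum>k\<in>UNIV. w $ k)"
  have c: "c \<ge> 0" by (simp add: c_def sum_nonneg weight_nonneg)
  define h where "h = e / (c + 1)"
  have h: "h > 0" "h * c < e" using e c by (auto simp: h_def field_simps)
  have "eventually (\<lambda>s. \<forall>k. X t $ k - h < X s $ k) (at_right t)"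
    by (intro eventually_all_finite order_tendstoD(1)[OF tendsto_vec_nth[OF X]]) (use h in auto)
  then obtain b where b: "t < b" "\<And>s k. t < s \<Longrightarrow> s < b \<Longrightarrow> X t $ k - h < X s $ k"
    by (auto simp: eventually_at_right_field)
  have "dist (L s $ i) (L t $ i) < e" if s: "s \<in> {t<..<b}" for s
  proof -
    define D where "D = L s - L t"
    have D_nonneg: "0 \<le> D $ k" for k
      using feasibleD(1)[OF L, of t s k] s t by (simp add: D_def)
    have "D $ k \<le> inflow D k + h" for k
    proof -
      have "L s $ k \<le> L t $ k + inflow D k + h"
      proof (rule tightD[OF tight])
        have inflow_D: "0 \<le> inflow D k" by (intro inflow_nonneg D_nonneg)
        then show "0 \<le> L t $ k + inflow D k + h"
          using h feasibleD(2)[OF L t, of k] by simp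
        fix r assume r: "0 \<le> r" "r \<le> s"
        show "inflow (L r) k - X r $ k \<le> L t $ k + inflow D k + h"
        proof (cases "r \<le> t")
          case True
          then show ?thesis
            using feasibleD(3)[OF L r(1), of k] feasibleD(1)[OF L r(1), of t k] inflow_D h by simp
        next
          case False
          have "inflow (L r) k \<le> inflow (L s) k" by (intro inflow_mono feasibleD(1)[OF L r])
          moreover have "X t $ k - h < X r $ k" using False r s by (intro b) auto
          ultimately show ?thesis
            using feasibleD(3)[OF L t, of k] unfolding D_def inflow_diff by linarith
        qed
      qed (use s t in auto)
      then show ?thesis by (simp add: D_def)
    qed
    then have "(\<Sum>k\<in>UNIV. D $ k) \<le> h * c"
      unfolding c_def by (rule sum_le_of_le_inflow)
    moreover have "D $ i \<le> (\<Sum>k\<in>UNIV. D $ k)"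
      by (intro member_le_sum) (auto simp: D_nonneg)
    ultimately show ?thesis
      using h D_nonneg[of i] by (simp add: D_def dist_real_def)
  qed
  then show "eventually (\<lambda>s. dist (L s $ i) (L t $ i) < e) (at_right t)"
    using b(1) by (intro eventually_at_rightI[of _ b]) auto
qed

lemma extended_regulator:
  assumes "\<And>t. t < 0 \<Longrightarrow> L t = 0" "feasible X L"
    and rc: "\<And>t. 0 \<le> t \<Longrightarrow> continuous (at_right t) (\<lambda>t. L t $ i)"
  shows "s \<le> t \<Longrightarrow> L s $ i \<le> L t $ i" and "continuous (at_right t) (\<lambda>t. L t $ i)"
proof -
  show "L s $ i \<le> L t $ i" if "s \<le> t"
    using that feasibleD(1)[OF assms(2), of s t i] feasibleD(2)[OF assms(2), of t i] assms(1)
    by (cases "s < 0"; cases "t < 0") auto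
  show "continuous (at_right t) (\<lambda>t. L t $ i)"
  proof (cases "t < 0")
    case True
    have "eventually (\<lambda>s. L s $ i = 0) (at_right t)"
      using True assms(1) by (intro eventually_at_rightI[of _ 0]) auto
    then show ?thesis
      using True assms(1) by (simp add: continuous_within tendsto_eventually)
  qed (use rc in auto)
qed

text \<open>Complementarity holds because a point \<open>t\<close> with \<open>W\<^sub>i(t) > 0\<close> satisfies the last two hypotheses of
  \<open>AE_notin_flat_set\<close>: immediately after \<open>t\<close> the quantity \<open>(P\<^sup>t L)\<^sub>i - X\<^sub>i\<close> stays below \<open>L\<^sub>i(t)\<close>, so tightness keeps
  \<open>L\<^sub>i\<close> from growing; and a jump of \<open>L\<^sub>i\<close> at \<open>t\<close> would by tightness end at \<open>(P\<^sup>t L)\<^sub>i(t) - X\<^sub>i(t)\<close>,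
  making \<open>W\<^sub>i(t) = 0\<close>.\<close>

lemma skorohod_solution_of_tight:
  assumes tight: "tight X L" and L: "feasible X L" and neg: "\<And>t. t < 0 \<Longrightarrow> L t = 0"
    and X: "\<And>t. 0 \<le> t \<Longrightarrow> (X \<longlongrightarrow> X t) (at_right t)"
  shows "skorohod_solution R X (\<lambda>t. if t < 0 then 0 else X t + R *v L t) L"
proof -
  define W where "W t = (if t < 0 then 0 else X t + R *v L t)" for t
  have W: "W t $ i = X t $ i + L t $ i - inflow (L t) i" if "0 \<le> t" for t i
    using that by (simp add: W_def R_apply)
  note rc0 = tight_right_continuous[OF tight L X]
  note ext = extended_regulator[OF neg L rc0]
  have "(\<integral>\<^sup>+t\<in>{0..}. indicator {t. W t $ i > 0} t \<partial>interval_measure (\<lambda>t. L t $ i)) = 0" for i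
  proof -
    have "AE t in interval_measure (\<lambda>t. L t $ i). t \<notin> {t. 0 \<le> t \<and> W t $ i > 0}"
    proof (rule AE_notin_flat_set)
      show "L x $ i \<le> L y $ i" if "x \<le> y" for x y using that by (intro ext) auto
      show "continuous (at_right a) (\<lambda>t. L t $ i)" for a by (intro ext) auto
      show "bdd_below {t. 0 \<le> t \<and> W t $ i > 0}" by (auto intro: bdd_belowI[where m = 0])
    next
      fix t assume "t \<in> {t. 0 \<le> t \<and> W t $ i > 0}"
      then have t: "0 \<le> t" "W t $ i > 0" by auto
      define g where "g = W t $ i / 2"
      have g: "g > 0" using t by (simp add: g_def)
      have "eventually (\<lambda>s. X t $ i - g < X s $ i) (at_right t)"
        by (intro order_tendstoD(1)[OF tendsto_vec_nth[OF X]]) (use g t in auto)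
      moreover have "eventually (\<lambda>s. inflow (L s) i < inflow (L t) i + g) (at_right t)"
      proof (rule order_tendstoD(2))
        show "((\<lambda>s. inflow (L s) i) \<longlongrightarrow> inflow (L t) i) (at_right t)"
          using rc0[OF t(1) t(1)]
          by (intro tendsto_sum tendsto_mult_left) (simp add: continuous_within)
      qed (use g in simp)
      ultimately have "eventually (\<lambda>s. inflow (L s) i - X s $ i \<le> L t $ i) (at_right t)"
        by eventually_elim (use W[OF t(1), of i] in \<open>simp add: g_def field_simps\<close>)
      then obtain b where b: "t < b" "\<And>s. t < s \<Longrightarrow> s < b \<Longrightarrow> inflow (L s) i - X s $ i \<le> L t $ i"
        by (auto simp: eventually_at_right_field)
      define q where "q = (t + b) / 2"
      have q: "t < q" "q < b" using b(1) by (auto simp: q_def)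
      have "L q $ i \<le> L t $ i"
      proof (rule tightD[OF tight])
        fix s assume s: "0 \<le> s" "s \<le> q"
        show "inflow (L s) i - X s $ i \<le> L t $ i"
          using feasibleD(3)[OF L s(1), of i] feasibleD(1)[OF L s(1), of t i] b(2)[of s] s q
          by (cases "s \<le> t") auto
      qed (use t q feasibleD(2)[OF L t(1), of i] in auto)
      then show "\<exists>q>t. L q $ i = L t $ i"
        using q feasibleD(1)[OF L t(1), of q i] by (intro exI[of _ q]) auto
    next
      fix t e :: real
      assume "t \<in> {t. 0 \<le> t \<and> W t $ i > 0}" and e: "e > 0"
      then have t: "0 \<le> t" "W t $ i > 0" by auto
      show "\<exists>s<t. L t $ i - L s $ i < e"
      proof (rule ccontr)
        assume "\<not> ?thesis"
        then have far: "L s $ i \<le> L t $ i - e" if "s < t" for s using that by force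
        \<comment> \<open>Before \<open>t\<close> the path stays \<open>e\<close> below \<open>L\<^sub>i(t)\<close>, and at \<open>t\<close> the gap is \<open>W\<^sub>i(t)\<close>; the smaller gap
          gives a level \<open>m\<close> to which tightness applies.\<close>
        define m where "m = L t $ i - min e (W t $ i)"
        have "0 \<le> L t $ i - e" using far[of "min t 0 - 1"] neg t by simp
        then have "m \<ge> 0" by (simp add: m_def)
        have "L t $ i \<le> m"
        proof (rule tightD[OF tight t(1) \<open>m \<ge> 0\<close>])
          fix s assume s: "0 \<le> s" "s \<le> t"
          show "inflow (L s) i - X s $ i \<le> m"
          proof (cases "s = t")
            case True
            then show ?thesis using W[OF t(1), of i] by (simp add: m_def)
          next
            case False
            then show ?thesis
              using feasibleD(3)[OF L s(1), of i] far[of s] s by (simp add: m_def)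
          qed
        qed
        then show False using e t by (simp add: m_def)
      qed
    qed
    then have "AE t in interval_measure (\<lambda>t. L t $ i).
        indicator {t. W t $ i > 0} t * indicator {0..} t = (0::ennreal)"
      by eventually_elim (auto simp: indicator_def)
    then show ?thesis
      by (subst nn_integral_cong_AE) auto
  qed
  then have "skorohod_solution R X W L"
    using L rc0 neg unfolding skorohod_solution_def feasible_def
    by (auto simp: W_def)
  then show ?thesis unfolding W_def .
qed

text \<open>Suppose \<open>(P\<^sup>t L)\<^sub>i - X\<^sub>i \<le> m\<close> on \<open>[0,t]\<close>, although \<open>L\<^sub>i(t) > m\<close>. On the set \<open>S\<close> of
  times in \<open>[0,t]\<close> at which \<open>L\<^sub>i > m\<close> one has \<open>W\<^sub>i > 0\<close>, so \<open>S\<close> is a null set of the measure of \<open>L\<^sub>i\<close>. But \<open>S\<close> is an interval with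
  right end \<open>t\<close>, and \<open>L\<^sub>i\<close> increases from at most \<open>m\<close> to \<open>L\<^sub>i(t)\<close> on it.\<close>

lemma tight_of_skorohod_solution:
  assumes "skorohod_solution R X W L"
  shows "feasible X L" and "tight X L"
proof -
  have neg: "\<And>t. t < 0 \<Longrightarrow> L t = 0"
    and W: "\<And>t. 0 \<le> t \<Longrightarrow> W t = X t + R *v L t"
    and rc0: "\<And>t i. 0 \<le> t \<Longrightarrow> continuous (at_right t) (\<lambda>t. L t $ i)"
    and compl: "\<And>i. (\<integral>\<^sup>+t\<in>{0..}. indicator {t. W t $ i > 0} t \<partial>interval_measure (\<lambda>t. L t $ i)) = 0"
    using assms by (auto simp: skorohod_solution_def)
  show L: "feasible X L"
    using assms by (fastforce simp: skorohod_solution_def feasible_def)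
  note ext = extended_regulator[OF neg L rc0]
  show "tight X L"
    unfolding tight_def
  proof (intro allI impI)
    fix i and t m :: real
    assume t: "0 \<le> t" and m: "0 \<le> m" and le: "\<forall>s\<in>{0..t}. inflow (L s) i - X s $ i \<le> m"
    define F where "F = (\<lambda>t. L t $ i)"
    have F: "\<And>x y. x \<le> y \<Longrightarrow> F x \<le> F y" "\<And>a. continuous (at_right a) F"
      unfolding F_def by (auto intro: ext)
    note Ioc = emeasure_interval_measure_Ioc[of _ _ F, OF _ F]
    have F_neg: "F s = 0" if "s < 0" for s using neg[OF that] by (simp add: F_def)
    show "L t $ i \<le> m"
    proof (rule ccontr)
      assume "\<not> ?thesis"
      then have Ft: "m < F t" by (simp add: F_def)
      define S where "S = {s\<in>{0..t}. m < F s}"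
      have S_null: "emeasure (interval_measure F) A = 0" if "A \<subseteq> S" "A \<in> sets borel" for A
      proof -
        have "W s $ i > 0" if "s \<in> S" for s
        proof -
          have "W s $ i = X s $ i + F s - inflow (L s) i"
            using that W[of s] by (simp add: S_def F_def R_apply)
          moreover have "inflow (L s) i - X s $ i \<le> m" "m < F s"
            using that le by (auto simp: S_def)
          ultimately show ?thesis by linarith
        qed
        then have "(\<integral>\<^sup>+s. indicator A s \<partial>interval_measure F)
            \<le> (\<integral>\<^sup>+s\<in>{0..}. indicator {s. W s $ i > 0} s \<partial>interval_measure F)"
          using \<open>A \<subseteq> S\<close> by (intro nn_integral_mono) (auto simp: indicator_def S_def)
        then show ?thesis using compl[of i] that(2) by (simp add: F_def)
      qed
      define \<tau> where "\<tau> = Inf S"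
      have S: "t \<in> S" "bdd_below S" using t Ft by (auto simp: S_def intro: bdd_belowI[where m = 0])
      have \<tau>: "\<tau> \<le> t" "0 \<le> \<tau>"
        unfolding \<tau>_def using S by (auto intro!: cInf_lower cInf_greatest simp: S_def)
      have below: "F s \<le> m" if "s < \<tau>" for s
      proof (rule ccontr)
        assume "\<not> F s \<le> m"
        moreover from this have "0 \<le> s" using F_neg[of s] m by force
        ultimately have "s \<in> S" using that \<tau> by (auto simp: S_def)
        then have "\<tau> \<le> s" unfolding \<tau>_def using S by (intro cInf_lower) auto
        with that show False by simp
      qed
      have above: "s \<in> S" if "\<tau> < s" "s \<le> t" for s
      proof -
        have "\<exists>r\<in>S. r < s"
          using S(1) that(1) by (intro cInf_lessD) (auto simp: \<tau>_def)
        then obtain r where "r \<in> S" "r < s" by blast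
        then show ?thesis using F(1)[of r s] that by (auto simp: S_def)
      qed
      show False
      proof (cases "\<tau> \<in> S")
        case False
        then have "F \<tau> \<le> m" using \<tau> by (auto simp: S_def)
        moreover have "emeasure (interval_measure F) {\<tau><..t} = 0"
          using above by (intro S_null) auto
        ultimately show False using Ft Ioc[OF \<tau>(1)] by (simp add: ennreal_eq_0_iff)
      next
        case True
        \<comment> \<open>Now \<open>L\<^sub>i\<close> may jump at \<open>\<tau>\<close>, so its value there says nothing about the level before \<open>\<tau>\<close>; that part is
          exhausted from the left. The intervals start at \<open>-1\<close> to include a possible atom at \<open>0\<close>.\<close>
        define A where "A n = {-1<..\<tau> - 1 / real (Suc n)}" for n
        have "emeasure (interval_measure F) {-1<..<\<tau>} \<le> ennreal m"
        proof -
          have "{-1<..<\<tau>} = (\<Union>n. A n)"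
          proof (intro equalityI subsetI)
            fix s assume s: "s \<in> {-1<..<\<tau>}"
            then obtain n where "inverse (real (Suc n)) < \<tau> - s"
              using reals_Archimedean[of "\<tau> - s"] by auto
            with s show "s \<in> (\<Union>n. A n)"
              by (auto simp: A_def inverse_eq_divide intro!: exI[of _ n])
          qed (auto simp: A_def intro: order.strict_trans1)
          moreover have "incseq A"
          proof (rule incseq_SucI)
            fix n
            have "1 / real (Suc (Suc n)) \<le> 1 / real (Suc n)" by (intro frac_le) auto
            then show "A n \<subseteq> A (Suc n)" by (auto simp: A_def simp del: of_nat_Suc)
          qed
          moreover have "emeasure (interval_measure F) (A n) \<le> ennreal m" for n
          proof -
            have "1 / real (Suc n) \<le> 1" by simp
            then have "- 1 \<le> \<tau> - 1 / real (Suc n)" using \<tau>(2) by linarith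
            then have "emeasure (interval_measure F) (A n) = F (\<tau> - 1 / real (Suc n)) - F (- 1)"
              unfolding A_def by (rule Ioc)
            also have "\<dots> \<le> ennreal m"
              using below[of "\<tau> - 1 / real (Suc n)"] by (intro ennreal_leI) (simp add: F_neg)
            finally show ?thesis .
          qed
          moreover have "range A \<subseteq> sets (interval_measure F)" by (auto simp: A_def)
          ultimately show ?thesis by (metis SUP_emeasure_incseq SUP_least)
        qed
        moreover have "emeasure (interval_measure F) {\<tau>..t} = 0"
          using above True by (intro S_null) (auto simp: le_less)
        moreover have "emeasure (interval_measure F) {-1<..t}
            \<le> emeasure (interval_measure F) {-1<..<\<tau>} + emeasure (interval_measure F) {\<tau>..t}"
          by (intro order.trans[OF emeasure_mono emeasure_subadditive]) auto
        moreover have "emeasure (interval_measure F) {-1<..t} = F t"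
          using Ioc[of "-1" t] t by (simp add: F_neg)
        ultimately have "ennreal (F t) \<le> ennreal m" by simp
        then show False using Ft m by (simp add: ennreal_le_iff)
      qed
    qed
  qed
qed

text \<open>The regulator of any other solution is tight and feasible, so it and \<open>L\<close> lie below each other.\<close>

lemma reflected_path_eq:
  assumes "tight X L" "feasible X L" "\<And>t. t < 0 \<Longrightarrow> L t = 0"
    and "\<And>t. 0 \<le> t \<Longrightarrow> (X \<longlongrightarrow> X t) (at_right t)" and "0 \<le> t"
  shows "reflected_path R X t = X t + R *v L t"
proof -
  define W where "W t = (if t < 0 then 0 else X t + R *v L t)" for t
  have sol: "skorohod_solution R X W L"
    unfolding W_def by (rule skorohod_solution_of_tight[OF assms(1-4)])
  have unique: "V = W \<and> K = L" if "skorohod_solution R X V K" for V K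
  proof -
    note K = tight_of_skorohod_solution[OF that]
    have "K t = L t" for t
    proof (cases "t < 0")
      case True
      with that show ?thesis by (simp add: skorohod_solution_def assms(3))
    next
      case False
      then show ?thesis
        using tight_le_feasible[OF K(2,1) assms(2)] tight_le_feasible[OF assms(1,2) K(1)]
        by (auto simp: vec_eq_iff intro: antisym)
    qed
    then have "K = L" by auto
    moreover have "V t = W t" for t
      using that \<open>K = L\<close> by (cases "t < 0") (auto simp: skorohod_solution_def W_def)
    ultimately show ?thesis by auto
  qed
  have "reflection_map R X = (W, L)"
    unfolding reflection_map_def
  proof (rule the_equality)
    fix p assume "case p of (V, K) \<Rightarrow> skorohod_solution R X V K"
    then show "p = (W, L)" using unique[of "fst p" "snd p"] by (simp add: case_prod_beta prod_eq_iff)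
  qed (simp add: sol)
  then show ?thesis
    using \<open>0 \<le> t\<close> by (simp add: reflected_path_def W_def)
qed

end

section \<open>Cadlag paths and their running deficit\<close>

lemma cadlag_bounded:
  fixes X :: "real \<Rightarrow> 'a::real_normed_vector"
  assumes X: "cadlag X" and "0 \<le> T"
  shows "bounded (X ` {0..T})"
proof -
  have near: "\<exists>b>t. bounded (X ` {t..<b})" if "0 \<le> t" for t
  proof -
    have "(X \<longlongrightarrow> X t) (at_right t)" using X that by (simp add: cadlag_def)
    then have "eventually (\<lambda>s. dist (X s) (X t) < 1) (at_right t)" by (rule tendstoD) simp
    then obtain b where "t < b" "\<And>s. t < s \<Longrightarrow> s < b \<Longrightarrow> dist (X s) (X t) < 1"
      by (auto simp: eventually_at_right_field)
    then have "X ` {t..<b} \<subseteq> cball (X t) 1"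
      by (auto simp: dist_commute le_less)
    with \<open>t < b\<close> show ?thesis by (blast intro: bounded_subset bounded_cball)
  qed
  have near_left: "\<exists>a<t. bounded (X ` ({a<..<t} \<inter> {0..}))" if "0 \<le> t" for t
  proof (cases "t = 0")
    case True
    have "{- 1<..<t} \<inter> {0..} = {}" using True by auto
    then show ?thesis using True by (intro exI[of _ "- 1"]) simp
  next
    case False
    then have "t > 0" using that by simp
    then obtain l where "(X \<longlongrightarrow> l) (at_left t)" using X unfolding cadlag_def by blast
    then have "eventually (\<lambda>s. dist (X s) l < 1) (at_left t)" by (rule tendstoD) simp
    then obtain a where "a < t" "\<And>s. a < s \<Longrightarrow> s < t \<Longrightarrow> dist (X s) l < 1"
      by (auto simp: eventually_at_left_field)
    then have "X ` ({a<..<t} \<inter> {0..}) \<subseteq> cball l 1"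
      by (fastforce simp: dist_commute intro: less_imp_le)
    with \<open>a < t\<close> show ?thesis by (blast intro: bounded_subset bounded_cball)
  qed
  \<comment> \<open>The bisection principle also looks at intervals that reach below \<open>0\<close>, where nothing is known
    about \<open>X\<close>; intersecting with \<open>[0,\<infinity>)\<close> discards that part.\<close>
  define B where "B u v \<longleftrightarrow> bounded (X ` ({u..v} \<inter> {0..}))" for u v
  have "B 0 T"
    using \<open>0 \<le> T\<close>
  proof (induction rule: Bolzano)
    case (trans a b c)
    then have "X ` ({a..c} \<inter> {0..}) \<subseteq> X ` ({a..b} \<inter> {0..}) \<union> X ` ({b..c} \<inter> {0..})"
      by force
    moreover have "bounded (X ` ({a..b} \<inter> {0..}) \<union> X ` ({b..c} \<inter> {0..}))"
      using trans unfolding bounded_Un B_def by blast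
    ultimately show ?case unfolding B_def by (rule bounded_subset[rotated])
  next
    case (local t)
    obtain a b where ab: "a < t" "t < b" "bounded (X ` ({a<..<t} \<inter> {0..}))" "bounded (X ` {t..<b})"
      using near[OF local(1)] near_left[OF local(1)] by blast
    have "B u v" if "u \<le> t" "t \<le> v" "v - u < min (t - a) (b - t)" for u v
    proof -
      have "X ` ({u..v} \<inter> {0..}) \<subseteq> X ` ({a<..<t} \<inter> {0..}) \<union> X ` {t..<b}" using that by force
      moreover have "bounded (X ` ({a<..<t} \<inter> {0..}) \<union> X ` {t..<b})"
        unfolding bounded_Un using ab by blast
      ultimately show ?thesis unfolding B_def by (rule bounded_subset[rotated])
    qed
    then show ?case
      using ab(1,2) by (intro exI[of _ "min (t - a) (b - t)"]) auto
  qed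
  moreover have "{0..T} \<inter> {0..} = {0..T}" by auto
  ultimately show ?thesis by (simp add: B_def)
qed

lemma bdd_below_neg_part:
  fixes X :: "real \<Rightarrow> real^'n"
  assumes "cadlag X" "0 \<le> t"
  shows "bdd_below ((\<lambda>s. neg_part (X s $ j)) ` {0..t})"
proof -
  obtain b where b: "\<And>s. s \<in> {0..t} \<Longrightarrow> norm (X s) \<le> b"
    using cadlag_bounded[OF assms] unfolding bounded_iff by blast
  show ?thesis
  proof (rule bdd_belowI2)
    fix s assume "s \<in> {0..t}"
    then show "- b \<le> neg_part (X s $ j)"
      using b[of s] component_le_norm_cart[of "X s" j] by (auto simp: neg_part_def)
  qed
qed

lemma running_deficit:
  fixes X :: "real \<Rightarrow> real^'n"
  assumes X: "cadlag X"
  shows running_deficit_ge: "0 \<le> s \<Longrightarrow> s \<le> t \<Longrightarrow> - X s $ j \<le> running_deficit X t $ j"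
    and running_deficit_nonneg: "0 \<le> t \<Longrightarrow> 0 \<le> running_deficit X t $ j"
    and running_deficit_mono: "0 \<le> s \<Longrightarrow> s \<le> t \<Longrightarrow> running_deficit X s $ j \<le> running_deficit X t $ j"
    and running_deficit_le:
      "0 \<le> t \<Longrightarrow> 0 \<le> K \<Longrightarrow> (\<And>s. 0 \<le> s \<Longrightarrow> s \<le> t \<Longrightarrow> - K \<le> X s $ j) \<Longrightarrow> running_deficit X t $ j \<le> K"
proof -
  have Inf_le: "(INF s\<in>{0..t}. neg_part (X s $ j)) \<le> neg_part (X s $ j)" if "0 \<le> s" "s \<le> t" for s t
    using that by (intro cINF_lower bdd_below_neg_part X) auto
  show "- X s $ j \<le> running_deficit X t $ j" if "0 \<le> s" "s \<le> t"
    using Inf_le[OF that] by (simp add: running_deficit_def neg_part_def)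
  show "0 \<le> running_deficit X t $ j" if "0 \<le> t"
    using Inf_le[of 0 t] that by (simp add: running_deficit_def neg_part_def)
  show "running_deficit X s $ j \<le> running_deficit X t $ j" if "0 \<le> s" "s \<le> t"
    unfolding running_deficit_def using that
    by (auto intro!: cINF_superset_mono bdd_below_neg_part X)
  show "running_deficit X t $ j \<le> K"
    if "0 \<le> t" "0 \<le> K" "\<And>s. 0 \<le> s \<Longrightarrow> s \<le> t \<Longrightarrow> - K \<le> X s $ j"
  proof -
    have "- K \<le> (INF s\<in>{0..t}. neg_part (X s $ j))"
      using that by (intro cINF_greatest) (auto simp: neg_part_def)
    then show ?thesis by (simp add: running_deficit_def)
  qed
qed

text \<open>A finite lower bound of \<open>X\<^sub>j\<close> near infinity and the boundedness of \<open>X\<close> on compact intervals would give a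
  lower bound on all of \<open>[0,\<infinity>)\<close>, and thus an upper bound for the running deficit.\<close>

lemma Liminf_eq_minus_infinity:
  fixes X :: "real \<Rightarrow> real^'n"
  assumes X: "cadlag X" and unbdd: "\<not> bounded ((\<lambda>t. running_deficit X t $ j) ` {0..})"
  shows "Liminf at_top (\<lambda>t. ereal (X t $ j)) = - \<infinity>"
proof (rule ccontr)
  assume "Liminf at_top (\<lambda>t. ereal (X t $ j)) \<noteq> - \<infinity>"
  then have "- \<infinity> < Liminf at_top (\<lambda>t. ereal (X t $ j))" by simp
  then obtain c where "ereal c < Liminf at_top (\<lambda>t. ereal (X t $ j))"
    using ereal_dense2[of "- \<infinity>"] by blast
  then have "eventually (\<lambda>t. ereal c < ereal (X t $ j)) at_top" by (rule less_LiminfD)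
  then obtain T where T: "\<And>t. t \<ge> T \<Longrightarrow> c < X t $ j" by (auto simp: eventually_at_top_linorder)
  obtain b where b: "\<And>s. s \<in> {0..max 0 T} \<Longrightarrow> norm (X s) \<le> b"
    using cadlag_bounded[OF X, of "max 0 T"] unfolding bounded_iff by (metis imageI max.cobounded1)
  define K where "K = max 0 (max b (- c))"
  have "- K \<le> X s $ j" if "0 \<le> s" for s
    using T[of s] b[of s] component_le_norm_cart[of "X s" j] that by (cases "s \<le> T") (auto simp: K_def)
  then have "running_deficit X t $ j \<le> K" if "0 \<le> t" for t
    using that by (intro running_deficit_le X) (auto simp: K_def)
  then have "bounded ((\<lambda>t. running_deficit X t $ j) ` {0..})"
    using running_deficit_nonneg[OF X, of _ j] by (auto simp: bounded_iff intro!: exI[of _ K])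
  with unbdd show False by contradiction
qed

lemma cadlag_const_add:
  fixes X :: "real \<Rightarrow> 'a::real_normed_vector"
  assumes X: "cadlag X"
  shows "cadlag (\<lambda>s. a + X s)"
  unfolding cadlag_def
proof (intro conjI allI impI)
  show "((\<lambda>s. a + X s) \<longlongrightarrow> a + X t) (at_right t)" if "0 \<le> t" for t
    using X that by (intro tendsto_add tendsto_const) (simp add: cadlag_def)
  fix t :: real
  assume "0 < t"
  then obtain l where "(X \<longlongrightarrow> l) (at_left t)" using X unfolding cadlag_def by blast
  then have "((\<lambda>s. a + X s) \<longlongrightarrow> a + l) (at_left t)" by (intro tendsto_add tendsto_const)
  then show "\<exists>l. ((\<lambda>s. a + X s) \<longlongrightarrow> l) (at_left t)" by blast
qed

section \<open>The effect of shifting the path\<close>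

context subcritical_routing
begin

text \<open>This path \<open>Y\<close> has \<open>R Y = M(X)\<close>, and \<open>M(X)\<close> lifts every coordinate of \<open>X\<close> to a nonnegative one;
  nonnegativity of \<open>R\<inverse>\<close> passes monotonicity from \<open>M(X)\<close> to \<open>Y\<close>.\<close>

lemma feasible_running_deficit:
  assumes X: "cadlag X"
  shows "feasible X (\<lambda>t. matrix_inv R *v running_deficit X t)"
proof (rule feasibleI)
  fix i and t :: real
  assume t: "0 \<le> t"
  show "0 \<le> (matrix_inv R *v running_deficit X t) $ i"
    by (intro inverse_nonneg running_deficit_nonneg X t)
  show "inflow (matrix_inv R *v running_deficit X t) i - X t $ i
      \<le> (matrix_inv R *v running_deficit X t) $ i"
    using R_apply[of "matrix_inv R *v running_deficit X t" i] running_deficit_ge[OF X t order_refl, of i]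
    by (simp add: R_mult_inverse)
next
  fix i and s t :: real
  assume st: "0 \<le> s" "s \<le> t"
  have "0 \<le> (matrix_inv R *v (running_deficit X t - running_deficit X s)) $ i"
    by (intro inverse_nonneg) (simp add: running_deficit_mono X st)
  then show "(matrix_inv R *v running_deficit X s) $ i \<le> (matrix_inv R *v running_deficit X t) $ i"
    by (simp add: matrix_vector_mult_diff_distrib)
qed

text \<open>The regulator \<open>K\<close> of \<open>a + X\<close> and the regulator \<open>L\<close> of \<open>X\<close> satisfy \<open>0 \<le> K \<le> L \<le> R\<inverse> M(X)\<close>. So the terms
  \<open>- P\<^sup>t K\<close> and \<open>P\<^sup>t L\<close> together only help, and \<open>K\<^sub>i - L\<^sub>i\<close> costs at most \<open>(R\<inverse> M(X))\<^sub>i\<close>.\<close>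

lemma reflected_path_shift_ge:
  assumes X: "cadlag X" and a: "\<And>j. 0 \<le> a $ j" and t: "0 \<le> t"
  shows "a $ i - (matrix_inv R *v running_deficit X t) $ i
    \<le> reflected_path R (\<lambda>s. a + X s) t $ i - reflected_path R X t $ i"
proof -
  have aX: "cadlag (\<lambda>s. a + X s)" by (rule cadlag_const_add[OF X])
  obtain L where L: "feasible X L" "tight X L" "\<And>t. t < 0 \<Longrightarrow> L t = 0"
    using tight_feasible_exists[OF feasible_running_deficit[OF X]] by blast
  obtain K where K: "feasible (\<lambda>s. a + X s) K" "tight (\<lambda>s. a + X s) K" "\<And>t. t < 0 \<Longrightarrow> K t = 0"
    using tight_feasible_exists[OF feasible_running_deficit[OF aX]] by blast
  have "feasible (\<lambda>s. a + X s) L"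
  proof (rule feasibleI)
    show "inflow (L t) i - (a + X t) $ i \<le> L t $ i" if "0 \<le> t" for t i
      using feasibleD(3)[OF L(1) that, of i] a[of i] by simp
  qed (use feasibleD(1,2)[OF L(1)] in auto)
  then have le: "K t $ j \<le> L t $ j" for j
    by (intro tight_le_feasible[OF K(2,1)] t)
  have "L t $ i \<le> (matrix_inv R *v running_deficit X t) $ i"
    by (rule tight_le_feasible[OF L(2,1) feasible_running_deficit[OF X] t])
  moreover have "0 \<le> K t $ i" by (rule feasibleD(2)[OF K(1) t])
  moreover have "inflow (K t) i \<le> inflow (L t) i" by (intro inflow_mono le)
  moreover have "reflected_path R X t = X t + R *v L t"
    using X by (intro reflected_path_eq L t) (auto simp: cadlag_def)
  moreover have "reflected_path R (\<lambda>s. a + X s) t = a + X t + R *v K t"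
    using aX by (intro reflected_path_eq[where X = "\<lambda>s. a + X s"] K t) (auto simp: cadlag_def)
  ultimately show ?thesis
    by (simp add: R_apply)
qed

end

theorem theorem2p5:
  fixes P R :: "real^'n^'n" and X :: "real \<Rightarrow> real^'n" and i :: 'n
  assumes nonneg: "\<And>k l. 0 \<le> P $ k $ l"
    and radius: "spectral_radius P < 1"
    and R: "R = reflection_matrix P"
    and X: "cadlag X"
    and lim: "\<And>a :: real^'n. (\<And>j. 0 \<le> a $ j) \<Longrightarrow>
       ((\<lambda>t. reflected_path R (\<lambda>s. a + X s) t $ i - reflected_path R X t $ i) \<longlongrightarrow> 0) at_top"
  shows "\<not> bounded ((\<lambda>t. (matrix_inv R *v running_deficit X t) $ i) ` {0..}) \<and>
    (\<exists>j. \<not> bounded ((\<lambda>t. running_deficit X t $ j) ` {0..}) \<and>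
         Liminf at_top (\<lambda>t. ereal (X t $ j)) = -\<infinity>)"
proof -
  obtain w where w: "\<And>k. 0 \<le> w $ k" "\<And>k. (P *v w) $ k = w $ k - 1"
    using exists_weight_vector[OF nonneg radius] by blast
  have "subcritical_routing P w"
    by (rule subcritical_routing.intro) (use nonneg w in auto)
  note shift_ge = subcritical_routing.reflected_path_shift_ge[OF this X]
  have unbdd: "\<not> bounded ((\<lambda>t. (matrix_inv R *v running_deficit X t) $ i) ` {0..})"
  proof
    assume "bounded ((\<lambda>t. (matrix_inv R *v running_deficit X t) $ i) ` {0..})"
    then obtain b where b: "\<And>t. 0 \<le> t \<Longrightarrow> \<bar>(matrix_inv R *v running_deficit X t) $ i\<bar> \<le> b"
      by (auto simp: bounded_iff)
    then have "0 \<le> b" by force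
    define a :: "real^'n" where "a = (\<chi> j. b + 1)"
    have a: "0 \<le> a $ j" for j using \<open>0 \<le> b\<close> by (simp add: a_def)
    have "1 \<le> reflected_path R (\<lambda>s. a + X s) t $ i - reflected_path R X t $ i" if "0 \<le> t" for t
      using shift_ge[OF a that, of i] b[OF that] by (simp add: R a_def abs_le_iff)
    then have "eventually (\<lambda>t. 1 \<le> reflected_path R (\<lambda>s. a + X s) t $ i - reflected_path R X t $ i) at_top"
      by (rule eventually_at_top_linorderI)
    then have "(1::real) \<le> 0"
      by (rule tendsto_lowerbound[OF lim[OF a]]) simp
    then show False by simp
  qed
  moreover have "\<exists>j. \<not> bounded ((\<lambda>t. running_deficit X t $ j) ` {0..})"
  proof (rule ccontr)
    assume "\<not> ?thesis"
    then have "\<forall>j. \<exists>b. \<forall>t\<ge>0. \<bar>running_deficit X t $ j\<bar> \<le> b"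
      by (simp add: bounded_iff Ball_def)
    then obtain b where b: "\<And>t j. 0 \<le> t \<Longrightarrow> \<bar>running_deficit X t $ j\<bar> \<le> b j"
      by metis
    have "\<bar>\<Sum>j\<in>UNIV. matrix_inv R $ i $ j * running_deficit X t $ j\<bar>
        \<le> (\<Sum>j\<in>UNIV. \<bar>matrix_inv R $ i $ j\<bar> * b j)" if "0 \<le> t" for t
      by (rule order.trans[OF sum_abs])
        (auto simp: abs_mult intro!: sum_mono mult_left_mono b that)
    then have "bounded ((\<lambda>t. \<Sum>j\<in>UNIV. matrix_inv R $ i $ j * running_deficit X t $ j) ` {0..})"
      by (auto simp: bounded_iff)
    with unbdd show False by (simp add: matrix_vector_mult_def)
  qed
  ultimately show ?thesis
    using Liminf_eq_minus_infinity[OF X] by blast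
qed

end
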